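(* Let $n\ge1$, $\hbar>0$, $\alpha>0$, and let $R_\alpha:\mathbb{C}^n\to\mathbb{C}^n$, $R_\alpha(z)=\sqrt{\alpha}\,z$. The pull-back $R_\alpha^*$, $R_\alpha^*f=f\circ R_\alpha$, induces an isomorphism of Fréchet $^*$-algebras $$R_\alpha^*:\mathcal{A}_{\alpha\hbar}\longrightarrow\mathcal{A}_\hbar .$$ In particular, for all $f\in\mathcal{A}_{\alpha\hbar}$ and all $m\in\mathbb{N}$, $\ell\in\{0,\dots,2^m-1\}$, $R,S\in\mathbb{N}^n$, $$\|R_\alpha^*f\|^{0,\hbar}_{m,\ell,R,S}=\|f\|^{0,\alpha\hbar}_{m,\ell,R,S}.$$
   Context: Conventions: $\mathbb{N}=\{0,1,2,\dots\}$; $z=(z^1,\dots,z^n)$ are the standard holomorphic coordinates on $\mathbb{C}^n$; multiindex notation is the usual componentwise one; $\sum_{N=0}^\infty$ means summation over $N\in\mathbb{N}^n$ and $\sum_{I=0}^R$ summation over $I\in\mathbb{N}^n$ with $I\le R$. For $p\in\mathbb{C}^n$, $\hbar>0$, $f\in C^\infty(\mathbb{C}^n)$, $m\in\mathbb{N}$, $\ell\in\{0,\dots,2^m-1\}$, $R,S\in\mathbb{N}^n$ define recursively, with values in $[0,+\infty]$, $$h^{p,\hbar}_{0,0,R,S}(f)=\sum_{N=0}^\infty\frac{(2\hbar)^{|R|+|S|+|N|}}{N!}\left|\frac{\partial^{|R|+|S|+|N|}f}{\partial z^R\partial\overline{z}^{N+S}}(p)\right|^2,$$ and for $m\ge1$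 $$h^{p,\hbar}_{m,\ell,R,S}(f)=\sum_{N=0}^\infty\frac1{N!}\Big(\sum_{I=0}^R\sum_{J=0}^{N+S}\tbinom{R}{I}\tbinom{N+S}{J}h^{p,\hbar}_{m-1,\ell/2,I,J}(f)\Big)^2\quad(\ell\text{ even}),$$ $$h^{p,\hbar}_{m,\ell,R,S}(f)=\sum_{N=0}^\infty\frac1{N!}\Big(\sum_{I=0}^R\sum_{J=0}^{N+S}\tbinom{R}{I}\tbinom{N+S}{J}h^{p,\hbar}_{m-1,(\ell-1)/2,J,I}(f)\Big)^2\quad(\ell\text{ odd}).$$ Put $\|f\|^{p,\hbar}_{m,\ell,R,S}=\big(h^{p,\hbar}_{m,\ell,R,S}(f)\big)^{1/2^{m+1}}$ and $\widetilde{\mathcal{A}}_{p,\hbar}=\{f\in C^\infty(\mathbb{C}^n)\mid \|f\|^{p,\hbar}_{m,\ell,R,S}<\infty\text{ for all }m,\ell,R,S\}$. Define $\mathcal{A}_{p,\hbar}=\widetilde{\mathcal{A}}_{p,\hbar}/\{f\in C^\infty(\mathbb{C}^n)\mid \mathsf{j}^\infty_pf=0\}$ (quotient by the functions with vanishing $\infty$-jet at $p$), with the topology induced by all the seminorms; it is a Fréchet space. Every class has a unique real-analytic representative, so $\mathcal{A}_{p,\hbar}$ is identified with a subspace of $C^\omega(\mathbb{C}^n)$. The product $f\star^\hbar_{\mathrm{Wick}}g=\sum_{N=0}^\infty\frac{(2\hbar)^{|N|}}{N!}\frac{\partial^{|N|}f}{\partial z^N}\frac{\partial^{|N|}g}{\partial\overline{z}^N}$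 converges absolutely in $\mathcal{A}_{p,\hbar}$ and makes it a Fréchet $^*$-algebra with complex conjugation as involution. As a Fréchet $^*$-algebra, $\mathcal{A}_{p,\hbar}$ does not depend on $p$ and is denoted $\mathcal{A}_\hbar$; accordingly $\mathcal{A}_{\alpha\hbar}$ carries the product $\star^{\alpha\hbar}_{\mathrm{Wick}}$. *)

theory Defs
  imports "HOL-Analysis.Analysis"
begin

section \<open>Multiindices\<close>

text \<open>Multiindices are elements of \<open>nat ^ 'n\<close>, with the componentwise addition and order of
  the library.\<close>

definition mi_abs :: "nat ^ 'n \<Rightarrow> nat"
  where "mi_abs N = (\<Sum>i\<in>UNIV. N $ i)"

definition mi_fact :: "nat ^ 'n \<Rightarrow> nat"
  where "mi_fact N = (\<Prod>i\<in>UNIV. fact (N $ i))"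

definition mi_choose :: "nat ^ 'n \<Rightarrow> nat ^ 'n \<Rightarrow> nat"
  where "mi_choose N I = (\<Prod>i\<in>UNIV. (N $ i) choose (I $ i))"


section \<open>Smooth functions and Wirtinger derivatives\<close>

primrec Ck :: "nat \<Rightarrow> ('a::real_normed_vector \<Rightarrow> 'b::real_normed_vector) \<Rightarrow> bool" where
  "Ck 0 f \<longleftrightarrow> continuous_on UNIV f"
| "Ck (Suc k) f \<longleftrightarrow> (\<forall>x. f differentiable (at x)) \<and> (\<forall>v. Ck k (\<lambda>x. frechet_derivative f (at x) v))"

definition smooth :: "('a::real_normed_vector \<Rightarrow> 'b::real_normed_vector) \<Rightarrow> bool"
  where "smooth f \<longleftrightarrow> (\<forall>k. Ck k f)"

text \<open>With \<open>z k = x k + \<i> y k\<close>: \<open>d/dz k = (d/dx k - \<i> d/dy k) / 2\<close> and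
  \<open>d/dzbar k = (d/dx k + \<i> d/dy k) / 2\<close>; the Frechet derivatives are real ones.\<close>

definition dz :: "'n::finite \<Rightarrow> (complex ^ 'n \<Rightarrow> complex) \<Rightarrow> complex ^ 'n \<Rightarrow> complex"
  where "dz k f z =
    (frechet_derivative f (at z) (axis k 1) - \<i> * frechet_derivative f (at z) (axis k \<i>)) / 2"

definition dzbar :: "'n::finite \<Rightarrow> (complex ^ 'n \<Rightarrow> complex) \<Rightarrow> complex ^ 'n \<Rightarrow> complex"
  where "dzbar k f z =
    (frechet_derivative f (at z) (axis k 1) + \<i> * frechet_derivative f (at z) (axis k \<i>)) / 2"

text \<open>An arbitrary enumeration of the coordinates, used only to compose the partial derivatives
  in some order; these commute on smooth functions.\<close>

definition coords :: "'n::finite list"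
  where "coords = (SOME ks. distinct ks \<and> set ks = UNIV)"

lemma coords: "distinct (coords :: 'n::finite list)" "set (coords :: 'n::finite list) = UNIV"
proof -
  have "\<exists>ks :: 'n list. distinct ks \<and> set ks = UNIV"
    using finite_distinct_list[of "UNIV :: 'n set"] by auto
  then have "distinct (coords :: 'n list) \<and> set (coords :: 'n list) = UNIV"
    unfolding coords_def by (rule someI_ex)
  then show "distinct (coords :: 'n list)" "set (coords :: 'n list) = UNIV" by auto
qed

definition Dz :: "nat ^ 'n \<Rightarrow> (complex ^ 'n \<Rightarrow> complex) \<Rightarrow> complex ^ 'n \<Rightarrow> complex"
  where "Dz R = foldr (\<lambda>k. dz k ^^ (R $ k)) coords"

definition Dzbar :: "nat ^ 'n \<Rightarrow> (complex ^ 'n \<Rightarrow> complex) \<Rightarrow> complex ^ 'n \<Rightarrow> complex"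
  where "Dzbar S = foldr (\<lambda>k. dzbar k ^^ (S $ k)) coords"


section \<open>The functionals and the seminorms\<close>

fun hfun :: "complex ^ 'n \<Rightarrow> real \<Rightarrow> nat \<Rightarrow> nat \<Rightarrow> nat ^ 'n \<Rightarrow> nat ^ 'n
    \<Rightarrow> (complex ^ 'n \<Rightarrow> complex) \<Rightarrow> ennreal" where
  "hfun p hb 0 l R S f =
     (\<Sum>\<^sub>\<infinity>N. ennreal ((2 * hb) ^ (mi_abs R + mi_abs S + mi_abs N) / real (mi_fact N)
              * (cmod (Dz R (Dzbar (N + S) f) p))\<^sup>2))"
| "hfun p hb (Suc m) l R S f =
     (if even l then
        (\<Sum>\<^sub>\<infinity>N. ennreal (1 / real (mi_fact N)) *
          (\<Sum>I\<in>{0..R}. \<Sum>J\<in>{0..N + S}.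
             of_nat (mi_choose R I) * of_nat (mi_choose (N + S) J) * hfun p hb m (l div 2) I J f)\<^sup>2)
      else
        (\<Sum>\<^sub>\<infinity>N. ennreal (1 / real (mi_fact N)) *
          (\<Sum>I\<in>{0..R}. \<Sum>J\<in>{0..N + S}.
             of_nat (mi_choose R I) * of_nat (mi_choose (N + S) J) * hfun p hb m ((l - 1) div 2) J I f)\<^sup>2))"

text \<open>\<open>hb\<close> is Planck's constant. The root of order \<open>2 ^ (m + 1)\<close> of \<open>hfun\<close>, with values in \<open>[0, \<infinity>]\<close>. Only \<open>l < 2 ^ m\<close> is
  meaningful.\<close>

definition hnorm :: "complex ^ 'n \<Rightarrow> real \<Rightarrow> nat \<Rightarrow> nat \<Rightarrow> nat ^ 'n \<Rightarrow> nat ^ 'n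
    \<Rightarrow> (complex ^ 'n \<Rightarrow> complex) \<Rightarrow> ennreal"
  where "hnorm p hb m l R S f =
    (if hfun p hb m l R S f = \<infinity> then \<infinity>
     else ennreal (root (2 ^ (m + 1)) (enn2real (hfun p hb m l R S f))))"

definition pre_algebra :: "complex ^ 'n \<Rightarrow> real \<Rightarrow> (complex ^ 'n \<Rightarrow> complex) set"
  where "pre_algebra p hb =
    {f. smooth f \<and> (\<forall>m l R S. l < 2 ^ m \<longrightarrow> hnorm p hb m l R S f < \<infinity>)}"


section \<open>The quotient by the functions with vanishing jet\<close>

definition jet_zero :: "complex ^ 'n \<Rightarrow> (complex ^ 'n \<Rightarrow> complex) \<Rightarrow> bool"
  where "jet_zero p f \<longleftrightarrow> (\<forall>R S. Dz R (Dzbar S f) p = 0)"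

definition jet_rel :: "complex ^ 'n \<Rightarrow> ((complex ^ 'n \<Rightarrow> complex) \<times> (complex ^ 'n \<Rightarrow> complex)) set"
  where "jet_rel p = {(f, g). smooth f \<and> smooth g \<and> jet_zero p (\<lambda>z. f z - g z)}"

type_synonym 'n fclass = "(complex ^ 'n \<Rightarrow> complex) set"

definition class_add :: "complex ^ 'n \<Rightarrow> 'n fclass \<Rightarrow> 'n fclass \<Rightarrow> 'n fclass"
  where "class_add p X Y = (\<Union>f\<in>X. \<Union>g\<in>Y. jet_rel p `` {\<lambda>z. f z + g z})"

definition class_diff :: "complex ^ 'n \<Rightarrow> 'n fclass \<Rightarrow> 'n fclass \<Rightarrow> 'n fclass"
  where "class_diff p X Y = (\<Union>f\<in>X. \<Union>g\<in>Y. jet_rel p `` {\<lambda>z. f z - g z})"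

definition class_scale :: "complex ^ 'n \<Rightarrow> complex \<Rightarrow> 'n fclass \<Rightarrow> 'n fclass"
  where "class_scale p c X = (\<Union>f\<in>X. jet_rel p `` {\<lambda>z. c * f z})"

definition class_cnj :: "complex ^ 'n \<Rightarrow> 'n fclass \<Rightarrow> 'n fclass"
  where "class_cnj p X = (\<Union>f\<in>X. jet_rel p `` {\<lambda>z. cnj (f z)})"

text \<open>The quotient seminorm; \<open>hnorm\<close> only depends on the jet at \<open>p\<close>, so it is constant on each class
  and the infimum is this constant value.\<close>

definition class_norm :: "complex ^ 'n \<Rightarrow> real \<Rightarrow> nat \<Rightarrow> nat \<Rightarrow> nat ^ 'n \<Rightarrow> nat ^ 'n
    \<Rightarrow> 'n fclass \<Rightarrow> ennreal"
  where "class_norm p hb m l R S X = (INF f\<in>X. hnorm p hb m l R S f)"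

definition class_topology :: "complex ^ 'n \<Rightarrow> real \<Rightarrow> 'n fclass topology"
  where "class_topology p hb = topology_generated_by
    {{Y \<in> pre_algebra p hb // jet_rel p. class_norm p hb m l R S (class_diff p Y X) < ennreal \<epsilon>}
      | X m l R S \<epsilon>. X \<in> pre_algebra p hb // jet_rel p \<and> l < 2 ^ m \<and> \<epsilon> > 0}"


section \<open>The Wick product\<close>

definition wick_term :: "real \<Rightarrow> (complex ^ 'n \<Rightarrow> complex) \<Rightarrow> (complex ^ 'n \<Rightarrow> complex)
    \<Rightarrow> nat ^ 'n \<Rightarrow> complex ^ 'n \<Rightarrow> complex"
  where "wick_term hb f g N z =
    of_real ((2 * hb) ^ mi_abs N / real (mi_fact N)) * Dz N f z * Dzbar N g z"

text \<open>Absolute convergence of the Wick series to \<open>h\<close> with respect to all the seminorms.\<close>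

definition wick_sums :: "complex ^ 'n \<Rightarrow> real \<Rightarrow> (complex ^ 'n \<Rightarrow> complex)
    \<Rightarrow> (complex ^ 'n \<Rightarrow> complex) \<Rightarrow> (complex ^ 'n \<Rightarrow> complex) \<Rightarrow> bool"
  where "wick_sums p hb f g h \<longleftrightarrow>
    h \<in> pre_algebra p hb \<and>
    (\<forall>m l R S. l < 2 ^ m \<longrightarrow>
       (\<Sum>\<^sub>\<infinity>N. hnorm p hb m l R S (wick_term hb f g N)) < \<infinity> \<and>
       ((\<lambda>F. hnorm p hb m l R S (\<lambda>z. (\<Sum>N\<in>F. wick_term hb f g N z) - h z)) \<longlongrightarrow> 0)
         (finite_subsets_at_top UNIV))"

text \<open>The set of all limits of the Wick series is exactly one class (the seminorms at \<open>p\<close> vanish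
  simultaneously only on functions with vanishing jet), and empty if there were no convergence.\<close>

definition class_wick :: "complex ^ 'n \<Rightarrow> real \<Rightarrow> 'n fclass \<Rightarrow> 'n fclass \<Rightarrow> 'n fclass"
  where "class_wick p hb X Y = (\<Union>f\<in>X. \<Union>g\<in>Y. {h. wick_sums p hb f g h})"


section \<open>Topological *-algebras and their isomorphisms\<close>

record 'a top_star_algebra =
  space_of :: "'a set"
  add_of :: "'a \<Rightarrow> 'a \<Rightarrow> 'a"
  scale_of :: "complex \<Rightarrow> 'a \<Rightarrow> 'a"
  mult_of :: "'a \<Rightarrow> 'a \<Rightarrow> 'a"
  star_of :: "'a \<Rightarrow> 'a"
  topology_of :: "'a topology"

text \<open>For Frechet *-algebras, an isomorphism is an isomorphism of the underlying *-algebras which is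
  a homeomorphism.\<close>

definition top_star_algebra_iso ::
    "'a top_star_algebra \<Rightarrow> 'b top_star_algebra \<Rightarrow> ('a \<Rightarrow> 'b) \<Rightarrow> bool"
  where "top_star_algebra_iso A B \<phi> \<longleftrightarrow>
    bij_betw \<phi> (space_of A) (space_of B) \<and>
    (\<forall>x\<in>space_of A. \<forall>y\<in>space_of A. \<phi> (add_of A x y) = add_of B (\<phi> x) (\<phi> y)) \<and>
    (\<forall>c. \<forall>x\<in>space_of A. \<phi> (scale_of A c x) = scale_of B c (\<phi> x)) \<and>
    (\<forall>x\<in>space_of A. \<forall>y\<in>space_of A. \<phi> (mult_of A x y) = mult_of B (\<phi> x) (\<phi> y)) \<and>
    (\<forall>x\<in>space_of A. \<phi> (star_of A x) = star_of B (\<phi> x)) \<and>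
    homeomorphic_map (topology_of A) (topology_of B) \<phi>"

definition wick_algebra_at :: "complex ^ 'n \<Rightarrow> real \<Rightarrow> 'n fclass top_star_algebra"
  where "wick_algebra_at p hb =
    \<lparr> space_of = pre_algebra p hb // jet_rel p,
      add_of = class_add p,
      scale_of = class_scale p,
      mult_of = class_wick p hb,
      star_of = class_cnj p,
      topology_of = class_topology p hb \<rparr>"

text \<open>The algebra does not depend on the base point up to canonical isomorphism; it is realised at
  the base point \<open>0\<close>.\<close>

definition wick_algebra :: "real \<Rightarrow> 'n::finite fclass top_star_algebra"
  where "wick_algebra hb = wick_algebra_at 0 hb"


section \<open>The rescaling\<close>

definition rescale :: "real \<Rightarrow> complex ^ 'n \<Rightarrow> complex ^ 'n"
  where "rescale \<alpha> z = sqrt \<alpha> *\<^sub>R z"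

text \<open>The map induced by the pull-back with \<open>rescale \<alpha>\<close> on the jet classes at \<open>0\<close>, which is a fixed
  point of \<open>rescale \<alpha>\<close>.\<close>

definition rescale_pullback :: "real \<Rightarrow> 'n::finite fclass \<Rightarrow> 'n fclass"
  where "rescale_pullback \<alpha> X = (\<Union>f\<in>X. jet_rel 0 `` {f \<circ> rescale \<alpha>})"

end

theory Submission
  imports Defs
begin

text \<open>The chain rule gives \<open>D (f \<circ> rescale \<alpha>) = sqrt \<alpha> ^ d * (D f \<circ> rescale \<alpha>)\<close> for every Wirtinger
  operator \<open>D\<close> of order \<open>d\<close>. At the fixed point \<open>0\<close> of the rescaling the factors
  \<open>\<bar>sqrt \<alpha> ^ d\<bar>\<^sup>2 = \<alpha> ^ d\<close> turn the weights \<open>(2 * hb) ^ d\<close> into \<open>(2 * \<alpha> * hb) ^ d\<close>, both in the seminorms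
  and in the Wick series, so the pull-back is isometric for every seminorm and multiplicative; its
  inverse is the pull-back with \<open>rescale (inverse \<alpha>)\<close>.\<close>

section \<open>Smooth functions\<close>

text \<open>Derivatives are unique, so an explicit \<open>f'\<close> may replace
  \<open>frechet_derivative f\<close>. Each closure property below then reduces to a derivative
  formula and an induction on \<open>k\<close>.\<close>

lemma Ck_SucI:
  assumes "\<And>x. (f has_derivative f' x) (at x)" and "\<And>v. Ck k (\<lambda>x. f' x v)"
  shows "Ck (Suc k) f"
proof -
  have "frechet_derivative f (at x) = f' x" for x
    using frechet_derivative_at[OF assms(1)] by simp
  then show ?thesis
    using assms by (auto simp: differentiable_def)
qed

lemma Ck_Suc_has_derivative:
  assumes "Ck (Suc k) f"
  shows "(f has_derivative frechet_derivative f (at x)) (at x)"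
  using assms frechet_derivative_works by auto

lemma Ck_Suc_imp_Ck: "Ck (Suc k) f \<Longrightarrow> Ck k f"
proof (induction k arbitrary: f)
  case 0
  then show ?case
    by (auto intro!: differentiable_imp_continuous_on simp: differentiable_on_def
        differentiable_at_withinI)
next
  case (Suc k)
  then show ?case by (metis Ck.simps(2))
qed

lemma Ck_bounded_linear:
  assumes "bounded_linear L" and "Ck k f"
  shows "Ck k (\<lambda>x. L (f x))"
  using assms(2)
proof (induction k arbitrary: f)
  case 0
  then show ?case by (simp add: bounded_linear.continuous_on[OF assms(1)])
next
  case (Suc k)
  show ?case
  proof (rule Ck_SucI)
    show "((\<lambda>x. L (f x)) has_derivative (\<lambda>v. L (frechet_derivative f (at x) v))) (at x)" for x
      by (rule bounded_linear.has_derivative[OF assms(1) Ck_Suc_has_derivative[OF Suc.prems]])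
    show "Ck k (\<lambda>x. L (frechet_derivative f (at x) v))" for v
      using Suc by simp
  qed
qed

lemma Ck_const: "Ck k (\<lambda>x. c)"
proof (induction k arbitrary: c)
  case (Suc k)
  show ?case by (rule Ck_SucI[where f' = "\<lambda>_ _. 0"]) (auto intro: Suc)
qed simp

lemma Ck_add: "Ck k f \<Longrightarrow> Ck k g \<Longrightarrow> Ck k (\<lambda>x. f x + g x)"
proof (induction k arbitrary: f g)
  case 0
  then show ?case by (simp add: continuous_on_add)
next
  case (Suc k)
  show ?case
  proof (rule Ck_SucI)
    show "((\<lambda>x. f x + g x) has_derivative
        (\<lambda>v. frechet_derivative f (at x) v + frechet_derivative g (at x) v)) (at x)" for x
      by (rule has_derivative_add[OF Ck_Suc_has_derivative[OF Suc.prems(1)]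
            Ck_Suc_has_derivative[OF Suc.prems(2)]])
    show "Ck k (\<lambda>x. frechet_derivative f (at x) v + frechet_derivative g (at x) v)" for v
      using Suc by simp
  qed
qed

lemma Ck_mult:
  fixes f g :: "'a::real_normed_vector \<Rightarrow> 'b::real_normed_algebra"
  shows "Ck k f \<Longrightarrow> Ck k g \<Longrightarrow> Ck k (\<lambda>x. f x * g x)"
proof (induction k arbitrary: f g)
  case 0
  then show ?case by (simp add: continuous_on_mult)
next
  case (Suc k)
  show ?case
  proof (rule Ck_SucI)
    show "((\<lambda>x. f x * g x) has_derivative
        (\<lambda>v. f x * frechet_derivative g (at x) v + frechet_derivative f (at x) v * g x)) (at x)" for x
      by (rule has_derivative_mult[OF Ck_Suc_has_derivative[OF Suc.prems(1)]
            Ck_Suc_has_derivative[OF Suc.prems(2)]])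
    show "Ck k (\<lambda>x. f x * frechet_derivative g (at x) v + frechet_derivative f (at x) v * g x)" for v
      \<comment> \<open>The Leibniz formula also contains the undifferentiated factors, whose
        regularity is lowered by one to fit the induction hypothesis.\<close>
      using Suc.prems Suc.prems[THEN Ck_Suc_imp_Ck] by (intro Ck_add Suc.IH) simp_all
  qed
qed

text \<open>Chain rule, with the real factor \<open>s\<close> moved out of the real-linear map
  \<open>f'\<close>. The direction \<open>v\<close> stays unscaled, which makes the homogeneity
  degree of a directional derivative visible.\<close>

lemma has_derivative_scaled_argument:
  assumes "(f has_derivative f') (at (s *\<^sub>R x))"
  shows "((\<lambda>x. f (s *\<^sub>R x)) has_derivative (\<lambda>v. s *\<^sub>R f' v)) (at x)"
proof -
  have "((\<lambda>x. f (s *\<^sub>R x)) has_derivative (\<lambda>v. f' (s *\<^sub>R v))) (at x)"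
    by (rule has_derivative_compose[of "\<lambda>x. s *\<^sub>R x" "\<lambda>v. s *\<^sub>R v" x UNIV f f', OF _ assms])
      (intro has_derivative_scaleR_right has_derivative_ident)
  then show ?thesis
    using linear_scale[OF has_derivative_linear[OF assms]] by simp
qed

lemma Ck_scaled_argument: "Ck k f \<Longrightarrow> Ck k (\<lambda>x. f (s *\<^sub>R x))"
proof (induction k arbitrary: f)
  case 0
  then show ?case
    by (auto intro!: continuous_on_compose2[of UNIV f] continuous_intros)
next
  case (Suc k)
  show ?case
  proof (rule Ck_SucI)
    show "((\<lambda>x. f (s *\<^sub>R x)) has_derivative (\<lambda>v. s *\<^sub>R frechet_derivative f (at (s *\<^sub>R x)) v)) (at x)" for x
      by (rule has_derivative_scaled_argument[OF Ck_Suc_has_derivative[OF Suc.prems]])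
    show "Ck k (\<lambda>x. s *\<^sub>R frechet_derivative f (at (s *\<^sub>R x)) v)" for v
      using Suc.prems
      by (intro Ck_bounded_linear[OF bounded_linear_scaleR_right]
          Suc.IH[of "\<lambda>x. frechet_derivative f (at x) v"]) simp
  qed
qed

section \<open>Closure properties of smooth functions\<close>

lemma smooth_bounded_linear: "bounded_linear L \<Longrightarrow> smooth f \<Longrightarrow> smooth (\<lambda>x. L (f x))"
  by (simp add: smooth_def Ck_bounded_linear)

lemma smooth_const: "smooth (\<lambda>x. c)"
  by (simp add: smooth_def Ck_const)

lemma smooth_add: "smooth f \<Longrightarrow> smooth g \<Longrightarrow> smooth (\<lambda>x. f x + g x)"
  by (simp add: smooth_def Ck_add)

lemma smooth_diff:
  assumes "smooth f" and "smooth g"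
  shows "smooth (\<lambda>x. f x - g x)"
  using smooth_add[OF assms(1) smooth_bounded_linear[OF _ assms(2), of uminus]]
  by (simp add: bounded_linear_minus bounded_linear_ident)

lemma smooth_mult:
  fixes f g :: "'a::real_normed_vector \<Rightarrow> 'b::real_normed_algebra"
  shows "smooth f \<Longrightarrow> smooth g \<Longrightarrow> smooth (\<lambda>x. f x * g x)"
  by (simp add: smooth_def Ck_mult)

lemma smooth_sum: "(\<And>i. i \<in> I \<Longrightarrow> smooth (f i)) \<Longrightarrow> smooth (\<lambda>x. \<Sum>i\<in>I. f i x)"
  by (induction I rule: infinite_finite_induct) (auto intro: smooth_add smooth_const)

lemma smooth_scaled_argument: "smooth f \<Longrightarrow> smooth (\<lambda>x. f (s *\<^sub>R x))"
  by (simp add: smooth_def Ck_scaled_argument)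

lemma smooth_has_derivative:
  "smooth f \<Longrightarrow> (f has_derivative frechet_derivative f (at x)) (at x)"
  unfolding smooth_def by (blast intro: Ck_Suc_has_derivative)

lemma smooth_frechet_derivative:
  assumes "smooth f"
  shows "smooth (\<lambda>x. frechet_derivative f (at x) v)"
  unfolding smooth_def
proof
  fix k
  have "Ck (Suc k) f" using assms unfolding smooth_def by blast
  then show "Ck k (\<lambda>x. frechet_derivative f (at x) v)" by simp
qed


section \<open>Homogeneous differential operators\<close>

text \<open>An abstraction of constant-coefficient operators that are homogeneous of order
  \<open>d\<close>: complex linearity on smooth functions (with differences, as jets are compared by
  subtraction) and degree \<open>d\<close> under real dilations.\<close>

definition diff_op ::
    "nat \<Rightarrow> (('a::real_normed_vector \<Rightarrow> complex) \<Rightarrow> 'a \<Rightarrow> complex) \<Rightarrow> bool"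
  where "diff_op d D \<longleftrightarrow>
    (\<forall>f. smooth f \<longrightarrow> smooth (D f)) \<and>
    (\<forall>f g. smooth f \<longrightarrow> smooth g \<longrightarrow> D (\<lambda>z. f z - g z) = (\<lambda>z. D f z - D g z)) \<and>
    (\<forall>c f. smooth f \<longrightarrow> D (\<lambda>z. c * f z) = (\<lambda>z. c * D f z)) \<and>
    (\<forall>s f. smooth f \<longrightarrow> D (\<lambda>z. f (s *\<^sub>R z)) = (\<lambda>z. of_real (s ^ d) * D f (s *\<^sub>R z)))"

lemma diff_opD:
  assumes "diff_op d D" and "smooth f"
  shows "smooth (D f)"
    and "smooth g \<Longrightarrow> D (\<lambda>z. f z - g z) = (\<lambda>z. D f z - D g z)"
    and "D (\<lambda>z. c * f z) = (\<lambda>z. c * D f z)"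
    and "D (\<lambda>z. f (s *\<^sub>R z)) = (\<lambda>z. of_real (s ^ d) * D f (s *\<^sub>R z))"
  using assms unfolding diff_op_def by blast+

lemma diff_op_id: "diff_op 0 (\<lambda>f. f)"
  by (simp add: diff_op_def)

text \<open>Orders add: complex homogeneity of \<open>D\<close> pulls out the factor
  \<open>s ^ e\<close> produced by \<open>E\<close>, and the dilation rule of \<open>D\<close> then
  contributes \<open>s ^ d\<close>.\<close>

lemma diff_op_compose:
  assumes "diff_op d D" and "diff_op e E"
  shows "diff_op (d + e) (\<lambda>f. D (E f))"
  unfolding diff_op_def
  by (auto simp: diff_opD[OF assms(1)] diff_opD[OF assms(2)] smooth_scaled_argument
      power_add algebra_simps)

lemma diff_op_funpow: "diff_op d D \<Longrightarrow> diff_op (n * d) (D ^^ n)"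
proof (induction n)
  case 0
  then show ?case using diff_op_id by (simp add: id_def)
next
  case (Suc n)
  then show ?case using diff_op_compose[of d D "n * d" "D ^^ n"] by (simp add: comp_def)
qed

lemma diff_op_foldr:
  assumes "\<And>k. diff_op (e k) (D k)"
  shows "diff_op (\<Sum>k\<leftarrow>ks. e k) (foldr D ks)"
proof (induction ks)
  case Nil
  show ?case using diff_op_id by (simp add: id_def)
next
  case (Cons k ks)
  then show ?case using diff_op_compose[OF assms] by (simp add: comp_def)
qed

lemma diff_op_frechet_derivative: "diff_op 1 (\<lambda>f z. frechet_derivative f (at z) v)"
proof -
  have "frechet_derivative (\<lambda>z. f z - g z) (at z) v
      = frechet_derivative f (at z) v - frechet_derivative g (at z) v"
    if "smooth f" "smooth g" for f g :: "'a \<Rightarrow> complex" and z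
    using frechet_derivative_at[OF has_derivative_diff[OF smooth_has_derivative[OF that(1)]
          smooth_has_derivative[OF that(2)]], of z] by metis
  moreover have "frechet_derivative (\<lambda>z. c * f z) (at z) v = c * frechet_derivative f (at z) v"
    if "smooth f" for f :: "'a \<Rightarrow> complex" and c z
    using frechet_derivative_at[OF has_derivative_mult_right[OF smooth_has_derivative[OF that]], of c z]
    by metis
  moreover have "frechet_derivative (\<lambda>z. f (s *\<^sub>R z)) (at z) v
      = of_real s * frechet_derivative f (at (s *\<^sub>R z)) v"
    if "smooth f" for f :: "'a \<Rightarrow> complex" and s z
    using frechet_derivative_at[OF has_derivative_scaled_argument[OF smooth_has_derivative[OF that]], of s z]
    by (metis scaleR_conv_of_real)
  ultimately show ?thesis
    by (simp add: diff_op_def smooth_frechet_derivative)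
qed

text \<open>The coefficients are complex, so this covers the Wirtinger derivatives, which combine
  two real directional derivatives.\<close>

lemma diff_op_linear_combination:
  assumes "diff_op d D" and "diff_op d E"
  shows "diff_op d (\<lambda>f z. a * D f z + b * E f z)"
  unfolding diff_op_def
  by (auto simp: diff_opD[OF assms(1)] diff_opD[OF assms(2)] algebra_simps
      intro!: smooth_add smooth_mult smooth_const)

lemma diff_op_dz: "diff_op 1 (dz k)"
proof -
  have "dz k = (\<lambda>f z. (1/2) * frechet_derivative f (at z) (axis k 1)
      + (- \<i>/2) * frechet_derivative f (at z) (axis k \<i>))"
    by (intro ext) (simp add: dz_def field_simps)
  then show ?thesis
    by (simp only: diff_op_linear_combination[OF diff_op_frechet_derivative diff_op_frechet_derivative])
qed

lemma diff_op_dzbar: "diff_op 1 (dzbar k)"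
proof -
  have "dzbar k = (\<lambda>f z. (1/2) * frechet_derivative f (at z) (axis k 1)
      + (\<i>/2) * frechet_derivative f (at z) (axis k \<i>))"
    by (intro ext) (simp add: dzbar_def field_simps)
  then show ?thesis
    by (simp only: diff_op_linear_combination[OF diff_op_frechet_derivative diff_op_frechet_derivative])
qed

text \<open>\<open>coords\<close> lists every coordinate exactly once, so the order of the composed
  operator is \<open>mi_abs R\<close> whichever enumeration was chosen.\<close>

lemma sum_list_coords: "(\<Sum>k\<leftarrow>coords. R $ k) = mi_abs R"
  unfolding mi_abs_def using sum_list_distinct_conv_sum_set[OF coords(1)] coords(2) by metis

lemma diff_op_Dz: "diff_op (mi_abs R) (Dz R)"
  unfolding Dz_def sum_list_coords[symmetric]
  by (rule diff_op_foldr) (use diff_op_funpow[OF diff_op_dz] in simp)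

lemma diff_op_Dzbar: "diff_op (mi_abs S) (Dzbar S)"
  unfolding Dzbar_def sum_list_coords[symmetric]
  by (rule diff_op_foldr) (use diff_op_funpow[OF diff_op_dzbar] in simp)

lemma diff_op_Dz_Dzbar: "diff_op (mi_abs R + mi_abs S) (\<lambda>f. Dz R (Dzbar S f))"
  by (intro diff_op_compose diff_op_Dz diff_op_Dzbar)


section \<open>Jets\<close>

text \<open>Linearity of the derivatives turns a vanishing jet of the difference into equality of
  jets. In this form symmetry, transitivity and reflexivity on smooth functions are
  immediate.\<close>

lemma jet_rel_iff:
  "(f, g) \<in> jet_rel p \<longleftrightarrow>
    smooth f \<and> smooth g \<and> (\<forall>R S. Dz R (Dzbar S f) p = Dz R (Dzbar S g) p)"
  using diff_opD(2)[OF diff_op_Dz_Dzbar, of f g] by (auto simp: jet_rel_def jet_zero_def)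

lemma jet_rel_diff_left:
  assumes "smooth u" and "(h, h') \<in> jet_rel p"
  shows "((\<lambda>z. u z - h z), (\<lambda>z. u z - h' z)) \<in> jet_rel p"
  using assms diff_opD(2)[OF diff_op_Dz_Dzbar, of u]
  by (auto simp: jet_rel_iff intro!: smooth_diff)

text \<open>The recursion reaches the function only through its base case, which reads derivatives
  at \<open>p\<close>.\<close>

lemma hfun_jet_rel:
  assumes "(f, g) \<in> jet_rel p"
  shows "hfun p hb m l R S f = hfun p hb m l R S g"
proof (induction m arbitrary: l R S)
  case 0
  show ?case using assms by (simp add: jet_rel_iff)
next
  case (Suc m)
  show ?case by (simp only: hfun.simps Suc)
qed

lemma hnorm_jet_rel: "(f, g) \<in> jet_rel p \<Longrightarrow> hnorm p hb m l R S f = hnorm p hb m l R S g"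
  by (simp add: hnorm_def hfun_jet_rel)

lemma pre_algebra_jet_rel:
  "(f, g) \<in> jet_rel p \<Longrightarrow> f \<in> pre_algebra p hb \<Longrightarrow> g \<in> pre_algebra p hb"
  by (simp add: pre_algebra_def hnorm_jet_rel[of f g] jet_rel_iff)

lemma smooth_Dz: "smooth f \<Longrightarrow> smooth (Dz N f)"
  by (rule diff_opD(1)[OF diff_op_Dz])

lemma smooth_Dzbar: "smooth f \<Longrightarrow> smooth (Dzbar N f)"
  by (rule diff_opD(1)[OF diff_op_Dzbar])

lemma smooth_wick_term: "smooth f \<Longrightarrow> smooth g \<Longrightarrow> smooth (wick_term hb f g N)"
  unfolding wick_term_def by (intro smooth_mult smooth_const smooth_Dz smooth_Dzbar)

text \<open>The limit enters only through membership in the pre-algebra and through seminorms of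
  differences, and both depend on its jet alone. The set of limits is therefore closed under
  \<open>jet_rel\<close>.\<close>

lemma wick_sums_jet_rel:
  assumes "smooth f" and "smooth g" and "(h, h') \<in> jet_rel p" and "wick_sums p hb f g h"
  shows "wick_sums p hb f g h'"
proof -
  have "hnorm p hb m l R S (\<lambda>z. (\<Sum>N\<in>F. wick_term hb f g N z) - h z)
      = hnorm p hb m l R S (\<lambda>z. (\<Sum>N\<in>F. wick_term hb f g N z) - h' z)" for m l R S F
    using assms by (intro hnorm_jet_rel jet_rel_diff_left smooth_sum smooth_wick_term)
  then show ?thesis
    using assms(4) pre_algebra_jet_rel[OF assms(3)] by (simp add: wick_sums_def)
qed


section \<open>The pull-back on functions\<close>

lemma comp_rescale: "f \<circ> rescale \<alpha> = (\<lambda>z. f (sqrt \<alpha> *\<^sub>R z))"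
  by (auto simp: rescale_def)

lemma rescale_inverse:
  assumes "\<alpha> > 0"
  shows "f \<circ> rescale (inverse \<alpha>) \<circ> rescale \<alpha> = f" "f \<circ> rescale \<alpha> \<circ> rescale (inverse \<alpha>) = f"
  using assms by (auto simp: rescale_def fun_eq_iff real_sqrt_inverse)

lemma smooth_rescale:
  assumes "\<alpha> > 0"
  shows "smooth (f \<circ> rescale \<alpha>) \<longleftrightarrow> smooth f"
proof
  assume "smooth (f \<circ> rescale \<alpha>)"
  then have "smooth (f \<circ> rescale \<alpha> \<circ> rescale (inverse \<alpha>))"
    unfolding comp_rescale[of "f \<circ> rescale \<alpha>"] by (rule smooth_scaled_argument)
  then show "smooth f" by (simp only: rescale_inverse[OF assms])
qed (simp add: comp_rescale smooth_scaled_argument)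

text \<open>At the fixed point \<open>0\<close> a derivative of order \<open>d\<close> is multiplied
  by \<open>sqrt \<alpha> ^ d\<close>, which is nonzero and cancels. If one of the functions is not
  smooth, both sides are false.\<close>

lemma jet_rel_rescale:
  assumes "\<alpha> > 0"
  shows "(f \<circ> rescale \<alpha>, g \<circ> rescale \<alpha>) \<in> jet_rel 0 \<longleftrightarrow> (f, g) \<in> jet_rel 0"
proof (cases "smooth f \<and> smooth g")
  case True
  then show ?thesis
    using assms smooth_rescale[OF assms, of f] smooth_rescale[OF assms, of g]
      diff_opD(4)[OF diff_op_Dz_Dzbar, of f _ _ "sqrt \<alpha>"] diff_opD(4)[OF diff_op_Dz_Dzbar, of g _ _ "sqrt \<alpha>"]
    by (simp add: jet_rel_iff comp_rescale)
next
  case False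
  then show ?thesis using smooth_rescale[OF assms] by (auto simp: jet_rel_iff)
qed

text \<open>Only the base case sees \<open>hb\<close>: there the squared modulus yields
  \<open>\<alpha> ^ d\<close>, which merges with the weight. The recursive clauses carry the
  equality upwards unchanged.\<close>

lemma hfun_rescale:
  assumes "\<alpha> > 0" and "smooth f"
  shows "hfun 0 hb m l R S (f \<circ> rescale \<alpha>) = hfun 0 (\<alpha> * hb) m l R S f"
proof (induction m arbitrary: l R S)
  case 0
  \<comment> \<open>The derivative has order \<open>mi_abs R + mi_abs (N + S)\<close>; additivity
    identifies this with the exponent of the weight.\<close>
  have abs_add: "mi_abs (N + S) = mi_abs N + mi_abs S" for N
    by (simp add: mi_abs_def sum.distrib)
  have "(2 * hb) ^ (mi_abs R + mi_abs S + mi_abs N) / real (mi_fact N)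
        * (cmod (Dz R (Dzbar (N + S) (f \<circ> rescale \<alpha>)) 0))\<^sup>2
      = (2 * (\<alpha> * hb)) ^ (mi_abs R + mi_abs S + mi_abs N) / real (mi_fact N)
        * (cmod (Dz R (Dzbar (N + S) f) 0))\<^sup>2" for N
  proof -
    define d where "d = mi_abs R + mi_abs S + mi_abs N"
    have "Dz R (Dzbar (N + S) (f \<circ> rescale \<alpha>)) 0 = of_real (sqrt \<alpha> ^ d) * Dz R (Dzbar (N + S) f) 0"
      using diff_opD(4)[OF diff_op_Dz_Dzbar assms(2), of R "N + S" "sqrt \<alpha>"]
      by (simp add: comp_rescale d_def abs_add add_ac)
    moreover have "(sqrt \<alpha> ^ d)\<^sup>2 = \<alpha> ^ d"
      using assms(1) by (metis less_imp_le power_commutes power_mult mult.commute real_sqrt_pow2)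
    ultimately show ?thesis
      using assms(1) unfolding d_def[symmetric]
      by (simp add: norm_mult power_mult_distrib norm_power)
  qed
  then show ?case by (simp only: hfun.simps)
next
  case (Suc m)
  show ?case by (simp only: hfun.simps Suc)
qed

lemma hnorm_rescale:
  "\<alpha> > 0 \<Longrightarrow> smooth f \<Longrightarrow> hnorm 0 hb m l R S (f \<circ> rescale \<alpha>) = hnorm 0 (\<alpha> * hb) m l R S f"
  by (simp add: hnorm_def hfun_rescale)

lemma pre_algebra_rescale:
  "\<alpha> > 0 \<Longrightarrow> f \<circ> rescale \<alpha> \<in> pre_algebra 0 hb \<longleftrightarrow> f \<in> pre_algebra 0 (\<alpha> * hb)"
  by (auto simp: pre_algebra_def smooth_rescale hnorm_rescale)

text \<open>The operators \<open>Dz N\<close> and \<open>Dzbar N\<close> each contribute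
  \<open>sqrt \<alpha> ^ mi_abs N\<close>; their product turns \<open>hb\<close> into
  \<open>\<alpha> * hb\<close>. This holds at every point, so the terms agree as functions and not
  merely as jets.\<close>

lemma wick_term_rescale:
  assumes "\<alpha> > 0" and "smooth f" and "smooth g"
  shows "wick_term hb (f \<circ> rescale \<alpha>) (g \<circ> rescale \<alpha>) N = wick_term (\<alpha> * hb) f g N \<circ> rescale \<alpha>"
proof
  fix z
  have "complex_of_real (sqrt \<alpha>) ^ mi_abs N * complex_of_real (sqrt \<alpha>) ^ mi_abs N
      = complex_of_real \<alpha> ^ mi_abs N"
    using assms(1) by (simp flip: power_mult_distrib of_real_mult)
  then show "wick_term hb (f \<circ> rescale \<alpha>) (g \<circ> rescale \<alpha>) N z
      = (wick_term (\<alpha> * hb) f g N \<circ> rescale \<alpha>) z"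
    using diff_opD(4)[OF diff_op_Dz assms(2), of N "sqrt \<alpha>"]
      diff_opD(4)[OF diff_op_Dzbar assms(3), of N "sqrt \<alpha>"]
    by (simp add: wick_term_def comp_rescale power_mult_distrib)
qed

lemma wick_sums_rescale:
  assumes "\<alpha> > 0" and "smooth f" and "smooth g"
  shows "wick_sums 0 hb (f \<circ> rescale \<alpha>) (g \<circ> rescale \<alpha>) (h \<circ> rescale \<alpha>) \<longleftrightarrow>
    wick_sums 0 (\<alpha> * hb) f g h"
proof (cases "smooth h")
  case True
  have "hnorm 0 hb m l R S (wick_term hb (f \<circ> rescale \<alpha>) (g \<circ> rescale \<alpha>) N)
      = hnorm 0 (\<alpha> * hb) m l R S (wick_term (\<alpha> * hb) f g N)" for m l R S N
    by (simp add: wick_term_rescale hnorm_rescale smooth_wick_term assms)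
  moreover have "hnorm 0 hb m l R S
        (\<lambda>z. (\<Sum>N\<in>F. wick_term hb (f \<circ> rescale \<alpha>) (g \<circ> rescale \<alpha>) N z) - (h \<circ> rescale \<alpha>) z)
      = hnorm 0 (\<alpha> * hb) m l R S (\<lambda>z. (\<Sum>N\<in>F. wick_term (\<alpha> * hb) f g N z) - h z)" for m l R S F
  proof -
    \<comment> \<open>Precomposition commutes with finite sums and differences, so the whole
      remainder is itself a pull-back and the isometry applies to it.\<close>
    have "(\<lambda>z. (\<Sum>N\<in>F. wick_term hb (f \<circ> rescale \<alpha>) (g \<circ> rescale \<alpha>) N z) - (h \<circ> rescale \<alpha>) z)
        = (\<lambda>z. (\<Sum>N\<in>F. wick_term (\<alpha> * hb) f g N z) - h z) \<circ> rescale \<alpha>"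
      by (auto simp: wick_term_rescale assms)
    moreover have "smooth (\<lambda>z. (\<Sum>N\<in>F. wick_term (\<alpha> * hb) f g N z) - h z)"
      by (intro smooth_diff smooth_sum smooth_wick_term assms True)
    ultimately show ?thesis by (simp only: hnorm_rescale[OF assms(1)])
  qed
  ultimately show ?thesis
    by (simp only: wick_sums_def pre_algebra_rescale[OF assms(1)])
next
  case False
  \<comment> \<open>Both sides fail, since limits must lie in the pre-algebra and hence be
    smooth.\<close>
  then show ?thesis
    using smooth_rescale[OF assms(1), of h] by (auto simp: wick_sums_def pre_algebra_def)
qed


section \<open>The pull-back on jet classes\<close>

text \<open>The class operations are unions over representatives; this moves the pull-back inside
  them.\<close>

lemma rescale_pullback_UN: "rescale_pullback \<alpha> (\<Union>i\<in>I. A i) = (\<Union>i\<in>I. rescale_pullback \<alpha> (A i))"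
  by (auto simp: rescale_pullback_def)

text \<open>On a union of jet classes the closure under \<open>jet_rel\<close> adds nothing: a
  function equivalent to \<open>f \<circ> rescale \<alpha>\<close> is again a pull-back, of a
  function equivalent to \<open>f\<close>. The pull-back becomes a plain image.\<close>

lemma rescale_pullback_saturated:
  assumes "\<alpha> > 0" and sat: "jet_rel 0 `` X = X"
  shows "rescale_pullback \<alpha> X = (\<lambda>f. f \<circ> rescale \<alpha>) ` X"
proof (intro set_eqI iffI)
  fix g
  assume "g \<in> rescale_pullback \<alpha> X"
  then obtain f where f: "f \<in> X" "(f \<circ> rescale \<alpha>, g) \<in> jet_rel 0"
    by (auto simp: rescale_pullback_def)
  define g' where "g' = g \<circ> rescale (inverse \<alpha>)"
  have g: "g = g' \<circ> rescale \<alpha>" by (simp only: g'_def rescale_inverse[OF assms(1)])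
  then have "(f, g') \<in> jet_rel 0" using f(2) by (simp add: jet_rel_rescale[OF assms(1)])
  then have "g' \<in> X" using f(1) sat by blast
  then show "g \<in> (\<lambda>f. f \<circ> rescale \<alpha>) ` X" using g by blast
next
  fix g
  assume "g \<in> (\<lambda>f. f \<circ> rescale \<alpha>) ` X"
  then obtain f where f: "f \<in> X" "g = f \<circ> rescale \<alpha>" by blast
  \<comment> \<open>Every member of a saturated set is smooth, because \<open>jet_rel\<close>
    relates only smooth functions; this gives reflexivity at the pull-back.\<close>
  have "smooth f" using f(1) sat by (auto simp: jet_rel_iff)
  then have "(f \<circ> rescale \<alpha>, g) \<in> jet_rel 0"
    using f(2) by (auto simp: jet_rel_iff smooth_rescale[OF assms(1)])
  then show "g \<in> rescale_pullback \<alpha> X" using f(1) by (auto simp: rescale_pullback_def)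
qed

lemma jet_rel_Image_Image: "jet_rel p `` (jet_rel p `` A) = jet_rel p `` A"
  by (auto simp: jet_rel_iff)

lemma saturated_quotient: "X \<in> A // jet_rel p \<Longrightarrow> jet_rel p `` X = X"
  by (elim quotientE) (simp add: jet_rel_Image_Image)

lemma saturated_smooth: "jet_rel p `` X = X \<Longrightarrow> f \<in> X \<Longrightarrow> smooth f"
  by (auto simp: jet_rel_iff)

lemma rescale_pullback_class:
  fixes f :: "complex ^ 'n::finite \<Rightarrow> complex"
  assumes "\<alpha> > 0"
  shows "rescale_pullback \<alpha> (jet_rel 0 `` {f}) = jet_rel 0 `` {f \<circ> rescale \<alpha>}"
proof (intro set_eqI)
  fix g :: "complex ^ 'n \<Rightarrow> complex"
  define g' where "g' = g \<circ> rescale (inverse \<alpha>)"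
  have g: "g = g' \<circ> rescale \<alpha>" by (simp only: g'_def rescale_inverse[OF assms])
  \<comment> \<open>\<open>g'\<close> is the only preimage of \<open>g\<close> under precomposition
    with the dilation, so membership in the image can be tested on \<open>g'\<close>.\<close>
  have "g' = h" if "g = h \<circ> rescale \<alpha>" for h
    unfolding g'_def that by (rule rescale_inverse(2)[OF assms])
  then have "g \<in> (\<lambda>f. f \<circ> rescale \<alpha>) ` (jet_rel 0 `` {f}) \<longleftrightarrow> (f, g') \<in> jet_rel 0"
    using g by blast
  also have "\<dots> \<longleftrightarrow> g \<in> jet_rel 0 `` {f \<circ> rescale \<alpha>}"
    using jet_rel_rescale[OF assms, of f g'] by (simp flip: g)
  finally show "g \<in> rescale_pullback \<alpha> (jet_rel 0 `` {f}) \<longleftrightarrow> g \<in> jet_rel 0 `` {f \<circ> rescale \<alpha>}"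
    by (simp only: rescale_pullback_saturated[OF assms jet_rel_Image_Image])
qed

lemma class_norm_rescale:
  assumes "\<alpha> > 0" and "jet_rel 0 `` X = X"
  shows "class_norm 0 hb m l R S (rescale_pullback \<alpha> X) = class_norm 0 (\<alpha> * hb) m l R S X"
  unfolding class_norm_def rescale_pullback_saturated[OF assms] image_image
  by (intro INF_cong refl hnorm_rescale assms saturated_smooth[OF assms(2)])

text \<open>Precomposition commutes with pointwise operations, and the unions over representatives
  are reindexed along the image. Differences, scalar multiples and conjugates follow the same
  pattern.\<close>

lemma class_add_rescale:
  assumes "\<alpha> > 0" and "jet_rel 0 `` X = X" and "jet_rel 0 `` Y = Y"
  shows "rescale_pullback \<alpha> (class_add 0 X Y) = class_add 0 (rescale_pullback \<alpha> X) (rescale_pullback \<alpha> Y)"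
  by (simp add: class_add_def rescale_pullback_UN rescale_pullback_class[OF assms(1)]
      rescale_pullback_saturated assms comp_def)

text \<open>Serves the topology, whose subbasic balls are defined by seminorms of
  differences.\<close>

lemma class_diff_rescale:
  assumes "\<alpha> > 0" and "jet_rel 0 `` X = X" and "jet_rel 0 `` Y = Y"
  shows "rescale_pullback \<alpha> (class_diff 0 X Y) = class_diff 0 (rescale_pullback \<alpha> X) (rescale_pullback \<alpha> Y)"
  by (simp add: class_diff_def rescale_pullback_UN rescale_pullback_class[OF assms(1)]
      rescale_pullback_saturated assms comp_def)

lemma class_scale_rescale:
  assumes "\<alpha> > 0" and "jet_rel 0 `` X = X"
  shows "rescale_pullback \<alpha> (class_scale 0 c X) = class_scale 0 c (rescale_pullback \<alpha> X)"
  by (simp add: class_scale_def rescale_pullback_UN rescale_pullback_class[OF assms(1)]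
      rescale_pullback_saturated assms comp_def)

lemma class_cnj_rescale:
  assumes "\<alpha> > 0" and "jet_rel 0 `` X = X"
  shows "rescale_pullback \<alpha> (class_cnj 0 X) = class_cnj 0 (rescale_pullback \<alpha> X)"
  by (simp add: class_cnj_def rescale_pullback_UN rescale_pullback_class[OF assms(1)]
      rescale_pullback_saturated assms comp_def)

lemma saturated_class_diff: "jet_rel p `` class_diff p X Y = class_diff p X Y"
  unfolding class_diff_def Image_UN jet_rel_Image_Image ..

text \<open>For each pair of representatives the set of limits is saturated, so its pull-back is an
  image, and \<open>wick_sums_rescale\<close> identifies that image with the limits of the rescaled
  series.\<close>

lemma class_wick_rescale:
  assumes "\<alpha> > 0" and X: "jet_rel 0 `` X = X" and Y: "jet_rel 0 `` Y = Y"
  shows "rescale_pullback \<alpha> (class_wick 0 (\<alpha> * hb) X Y)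
    = class_wick 0 hb (rescale_pullback \<alpha> X) (rescale_pullback \<alpha> Y)"
proof -
  have "rescale_pullback \<alpha> {h. wick_sums 0 (\<alpha> * hb) f g h}
      = {h. wick_sums 0 hb (f \<circ> rescale \<alpha>) (g \<circ> rescale \<alpha>) h}" if "f \<in> X" "g \<in> Y" for f g
  proof -
    have fg: "smooth f" "smooth g" using that saturated_smooth X Y by blast+
    have "jet_rel 0 `` {h. wick_sums 0 (\<alpha> * hb) f g h} = {h. wick_sums 0 (\<alpha> * hb) f g h}"
    proof (intro equalityI subsetI)
      fix h
      assume "h \<in> {h. wick_sums 0 (\<alpha> * hb) f g h}"
      \<comment> \<open>A limit lies in the pre-algebra, hence is smooth and equivalent to
        itself.\<close>
      moreover from this have "(h, h) \<in> jet_rel 0"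
        by (simp add: wick_sums_def pre_algebra_def jet_rel_iff)
      ultimately show "h \<in> jet_rel 0 `` {h. wick_sums 0 (\<alpha> * hb) f g h}" by blast
    qed (use wick_sums_jet_rel[OF fg] in blast)
    then have "rescale_pullback \<alpha> {h. wick_sums 0 (\<alpha> * hb) f g h}
        = (\<lambda>h. h \<circ> rescale \<alpha>) ` {h. wick_sums 0 (\<alpha> * hb) f g h}"
      by (rule rescale_pullback_saturated[OF assms(1)])
    also have "\<dots> = (\<lambda>h. h \<circ> rescale \<alpha>) `
        {h. wick_sums 0 hb (f \<circ> rescale \<alpha>) (g \<circ> rescale \<alpha>) (h \<circ> rescale \<alpha>)}"
      by (simp only: wick_sums_rescale[OF assms(1) fg])
    also have "\<dots> = {h. wick_sums 0 hb (f \<circ> rescale \<alpha>) (g \<circ> rescale \<alpha>) h}"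
    proof (intro set_eqI iffI)
      fix h
      assume "h \<in> {h. wick_sums 0 hb (f \<circ> rescale \<alpha>) (g \<circ> rescale \<alpha>) h}"
      then show "h \<in> (\<lambda>h. h \<circ> rescale \<alpha>) `
          {h. wick_sums 0 hb (f \<circ> rescale \<alpha>) (g \<circ> rescale \<alpha>) (h \<circ> rescale \<alpha>)}"
        \<comment> \<open>Precomposition with the inverse dilation supplies the preimage of an
          arbitrary limit.\<close>
        by (intro image_eqI[of _ _ "h \<circ> rescale (inverse \<alpha>)"])
          (simp_all only: rescale_inverse[OF assms(1)] mem_Collect_eq)
    qed auto
    finally show ?thesis .
  qed
  then show ?thesis
    by (simp add: class_wick_def rescale_pullback_UN rescale_pullback_saturated[OF assms(1) X]
        rescale_pullback_saturated[OF assms(1) Y])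
qed

lemma bij_betw_rescale_pullback:
  assumes "\<alpha> > 0"
  shows "bij_betw (rescale_pullback \<alpha>) (pre_algebra 0 (\<alpha> * hb) // jet_rel 0)
    (pre_algebra 0 hb // jet_rel 0)"
proof (rule bij_betwI[where g = "rescale_pullback (inverse \<alpha>)"])
  \<comment> \<open>The inverse map is the pull-back for \<open>inverse \<alpha>\<close>, applied
    with parameter \<open>\<alpha> * hb\<close>; \<open>cancel\<close> shows that its domain belongs
    to \<open>hb\<close>.\<close>
  have inv: "inverse \<alpha> > 0" and cancel: "inverse \<alpha> * (\<alpha> * hb) = hb" using assms by simp_all
  show "rescale_pullback \<alpha> \<in> pre_algebra 0 (\<alpha> * hb) // jet_rel 0 \<rightarrow> pre_algebra 0 hb // jet_rel 0"
    by (auto simp: rescale_pullback_class[OF assms] pre_algebra_rescale[OF assms]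
        elim!: quotientE intro!: quotientI)
  show "rescale_pullback (inverse \<alpha>) \<in> pre_algebra 0 hb // jet_rel 0 \<rightarrow> pre_algebra 0 (\<alpha> * hb) // jet_rel 0"
    by (auto simp: rescale_pullback_class[OF inv] pre_algebra_rescale[OF inv, of _ "\<alpha> * hb"] cancel
        elim!: quotientE intro!: quotientI)
  show "rescale_pullback (inverse \<alpha>) (rescale_pullback \<alpha> X) = X"
    if "X \<in> pre_algebra 0 (\<alpha> * hb) // jet_rel 0" for X
    using that
    by (auto simp: rescale_pullback_class[OF assms] rescale_pullback_class[OF inv]
        rescale_inverse[OF assms] elim!: quotientE)
  show "rescale_pullback \<alpha> (rescale_pullback (inverse \<alpha>) X) = X"
    if "X \<in> pre_algebra 0 hb // jet_rel 0" for X
    using that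
    by (auto simp: rescale_pullback_class[OF assms] rescale_pullback_class[OF inv]
        rescale_inverse[OF assms] elim!: quotientE)
qed


section \<open>The topology\<close>

text \<open>An injection that carries one subbasis onto another is a homeomorphism. Continuity is
  tested on subbasic sets in both directions, and the underlying spaces are the unions of the
  subbases.\<close>

lemma homeomorphic_map_topology_generated_by:
  assumes "inj_on \<phi> (\<Union>G)"
  shows "homeomorphic_map (topology_generated_by G) (topology_generated_by ((`) \<phi> ` G)) \<phi>"
proof -
  let ?H = "(`) \<phi> ` G"
  let ?\<psi> = "inv_into (\<Union>G) \<phi>"
  have UH: "\<Union>?H = \<phi> ` \<Union>G" by blast
  have inv: "?\<psi> (\<phi> x) = x" if "x \<in> V" "V \<in> G" for x V
    using that by (intro inv_into_f_f assms UnionI)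
  have "continuous_map (topology_generated_by G) (topology_generated_by ?H) \<phi>"
  proof (rule continuous_on_generated_topo)
    fix V
    assume "V \<in> ?H"
    then obtain U where U: "U \<in> G" "V = \<phi> ` U" by blast
    \<comment> \<open>Injectivity on the whole union prevents points outside \<open>U\<close> from
      being mapped into \<open>V\<close>.\<close>
    then have "\<phi> -` V \<inter> \<Union>G = U"
      using assms by (auto dest!: inj_onD)
    then show "openin (topology_generated_by G) (\<phi> -` V \<inter> topspace (topology_generated_by G))"
      using U by (simp add: topology_generated_by_topspace topology_generated_by_Basis)
  qed (simp add: UH topology_generated_by_topspace)
  moreover have "continuous_map (topology_generated_by ?H) (topology_generated_by G) ?\<psi>"
  proof (rule continuous_on_generated_topo)
    fix U
    assume U: "U \<in> G"
    then have "?\<psi> -` U \<inter> \<Union>?H = \<phi> ` U"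
      unfolding UH using inv by fastforce
    then show "openin (topology_generated_by ?H) (?\<psi> -` U \<inter> topspace (topology_generated_by ?H))"
      using U by (simp add: topology_generated_by_topspace topology_generated_by_Basis)
  qed (use inv in \<open>fastforce simp: UH topology_generated_by_topspace\<close>)
  ultimately have "homeomorphic_maps (topology_generated_by G) (topology_generated_by ?H) \<phi> ?\<psi>"
    using assms by (auto simp: homeomorphic_maps_def topology_generated_by_topspace UH
        inv_into_f_f f_inv_into_f)
  then show ?thesis by (rule homeomorphic_maps_imp_map)
qed

lemma homeomorphic_map_rescale_pullback:
  assumes "\<alpha> > 0"
  shows "homeomorphic_map (class_topology 0 (\<alpha> * hb)) (class_topology 0 hb)
    (rescale_pullback \<alpha> :: 'n::finite fclass \<Rightarrow> 'n fclass)"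
proof -
  let ?\<phi> = "rescale_pullback \<alpha> :: 'n fclass \<Rightarrow> 'n fclass"
  let ?P = "\<lambda>hb. pre_algebra 0 hb // jet_rel 0 :: 'n fclass set"
  define B where "B hb m l R S \<epsilon> X =
    {Y \<in> ?P hb. class_norm 0 hb m l R S (class_diff 0 Y X) < ennreal \<epsilon>}" for hb m l R S \<epsilon> X
  define G where "G hb = {B hb m l R S \<epsilon> X | X m l R S \<epsilon>. X \<in> ?P hb \<and> l < 2 ^ m \<and> \<epsilon> > 0}" for hb
  have top: "class_topology 0 hb = topology_generated_by (G hb)" for hb
    by (simp add: class_topology_def G_def B_def)
  note bij = bij_betw_rescale_pullback[OF assms, of hb, where 'a = 'n]
  \<comment> \<open>Every centre of a target ball is thus the image of a source centre, so the
    correspondence of balls is onto.\<close>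
  have surj: "?P hb = ?\<phi> ` ?P (\<alpha> * hb)"
    using bij by (simp add: bij_betw_def)
  have B: "?\<phi> ` B (\<alpha> * hb) m l R S \<epsilon> X = B hb m l R S \<epsilon> (?\<phi> X)"
    if X: "X \<in> ?P (\<alpha> * hb)" for m l R S \<epsilon> X
  proof -
    \<comment> \<open>Isometry on differences: balls map to balls of the same radius and the same
      seminorm.\<close>
    have "class_norm 0 hb m l R S (class_diff 0 (?\<phi> Y) (?\<phi> X))
        = class_norm 0 (\<alpha> * hb) m l R S (class_diff 0 Y X)" if "Y \<in> ?P (\<alpha> * hb)" for Y
      using class_diff_rescale[OF assms saturated_quotient[OF that] saturated_quotient[OF X]]
        class_norm_rescale[OF assms saturated_class_diff] by metis
    then show ?thesis unfolding B_def surj by auto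
  qed
  have "G hb = (`) ?\<phi> ` G (\<alpha> * hb)"
  proof (intro equalityI subsetI)
    fix V
    assume "V \<in> G hb"
    then obtain X m l R S \<epsilon> where V: "V = B hb m l R S \<epsilon> (?\<phi> X)" "X \<in> ?P (\<alpha> * hb)" "l < 2 ^ m" "\<epsilon> > 0"
      unfolding G_def surj by blast
    then have "B (\<alpha> * hb) m l R S \<epsilon> X \<in> G (\<alpha> * hb)" unfolding G_def by blast
    then show "V \<in> (`) ?\<phi> ` G (\<alpha> * hb)" using V(1) B[OF V(2)] by blast
  next
    fix V
    assume "V \<in> (`) ?\<phi> ` G (\<alpha> * hb)"
    then obtain X m l R S \<epsilon> where V: "V = ?\<phi> ` B (\<alpha> * hb) m l R S \<epsilon> X" "X \<in> ?P (\<alpha> * hb)" "l < 2 ^ m" "\<epsilon> > 0"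
      unfolding G_def by blast
    then show "V \<in> G hb" using B[OF V(2)] unfolding G_def surj by blast
  qed
  \<comment> \<open>The balls are subsets of the carrier, on which the pull-back is
    injective.\<close>
  moreover have "inj_on ?\<phi> (\<Union> (G (\<alpha> * hb)))"
    by (rule inj_on_subset[OF bij_betw_imp_inj_on[OF bij]]) (auto simp: G_def B_def)
  ultimately show ?thesis
    unfolding top by (simp only: homeomorphic_map_topology_generated_by)
qed

theorem theorem5p11:
  fixes hb \<alpha> :: real
  assumes "hb > 0" and "\<alpha> > 0"
  shows "top_star_algebra_iso
           (wick_algebra (\<alpha> * hb) :: 'n::finite fclass top_star_algebra)
           (wick_algebra hb) (rescale_pullback \<alpha>)
       \<and> (\<forall>X \<in> space_of (wick_algebra (\<alpha> * hb) :: 'n fclass top_star_algebra).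
            \<forall>m l R S. l < 2 ^ m \<longrightarrow>
              class_norm 0 hb m l R S (rescale_pullback \<alpha> X) = class_norm 0 (\<alpha> * hb) m l R S X)"
proof -
  \<comment> \<open>Elements of the quotient are saturated, as the compatibility lemmas for the
    operations and the seminorms require.\<close>
  note sat = saturated_quotient[of _ "pre_algebra 0 (\<alpha> * hb)" "0 :: complex ^ 'n"]
  show ?thesis
    unfolding top_star_algebra_iso_def wick_algebra_def wick_algebra_at_def top_star_algebra.simps
    using assms(2)
    by (intro conjI ballI allI impI bij_betw_rescale_pullback homeomorphic_map_rescale_pullback
        class_add_rescale class_scale_rescale class_wick_rescale class_cnj_rescale
        class_norm_rescale sat)
qed

end
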